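(* Let $p>5$ be a prime. Then, in $\mathbb{Z}_p$ modulo $p^4$, \begin{align*} H_{p-1,p-3}&\equiv\frac{37p^3}{12}-3p^2+\frac{3p}{4}-p^2(pB_{p-1})+3p(p-3)\mathcal{B}_{p+1}-\frac{1}{2}\Big(p-3+\frac{11p^3}{2}\Big)B_{2p}\pmod{p^4},\\ H_{p-1,p-1}&\equiv\frac{13p^3+12p-12}{3}+\frac{19p^3-12}{2}\,pB_{p-1}+(4-7p^3)\,pB_{2(p-1)}+\frac{11p^3-6}{6}\,pB_{3(p-1)}\pmod{p^4}. \end{align*}
   Context: $B_n$ denotes the $n$-th Bernoulli number and $\mathcal{B}_n:=B_n/n$ for $n\ge1$. For an integer $k\ge1$, $H_{p-1,k}:=\sum_{a=1}^{p-1}a^{-k}$ is the generalized harmonic number. Congruences are in $\mathbb{Q}_p$: $x\equiv y\pmod{p^4}$ means $x-y\in p^4\mathbb{Z}_p$. *)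

theory Defs
  imports "HOL-Computational_Algebra.Computational_Algebra"
begin

text \<open>Bernoulli numbers, by \<open>x / (exp x - 1) = (\<Sum>n. B n * x ^ n / n!)\<close>.\<close>

definition bernoulli :: "nat \<Rightarrow> rat" where
  "bernoulli n = fact n * fps_nth (fps_X / (fps_exp 1 - 1)) n"

lemma bernoulli_fps:
  "Abs_fps (\<lambda>n. bernoulli n / fact n) * (fps_exp 1 - 1) = fps_X"
proof -
  have nz: "fps_exp (1::rat) - 1 \<noteq> 0"
    by (auto simp: fps_eq_iff intro!: exI[of _ 1])
  have "subdegree (fps_exp (1::rat) - 1) = 1"
    by (rule subdegreeI) auto
  then have "(fps_exp (1::rat) - 1) dvd fps_X"
    using nz by (subst fps_dvd_iff) auto
  moreover have "Abs_fps (\<lambda>n. bernoulli n / fact n) = fps_X / (fps_exp 1 - 1)"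
    by (simp add: bernoulli_def fps_eq_iff)
  ultimately show ?thesis
    by simp
qed

lemma bernoulli_0: "bernoulli 0 = 1"
proof -
  have "fps_nth (Abs_fps (\<lambda>n. bernoulli n / fact n) * (fps_exp 1 - 1)) 1 = 1"
    by (simp add: bernoulli_fps)
  then show ?thesis
    by (simp add: fps_mult_nth)
qed

definition divided_bernoulli :: "nat \<Rightarrow> rat" where
  "divided_bernoulli n = bernoulli n / of_nat n"

definition gen_harmonic :: "nat \<Rightarrow> nat \<Rightarrow> rat" where
  "gen_harmonic n k = (\<Sum>a = 1..n. 1 / of_nat a ^ k)"

text \<open>
  All numbers considered are rational, so \<open>p\<close>-adic congruences are expressed inside
  the subfield of rationals, with the valuation it inherits from the \<open>p\<close>-adic numbers.
  The value of \<open>padic_val\<close> at 0 is junk, hence the separate case in \<open>padic_ints\<close>.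
\<close>

definition padic_val :: "nat \<Rightarrow> rat \<Rightarrow> int" where
  "padic_val p x =
     (case quotient_of x of (a, b) \<Rightarrow>
        int (multiplicity (int p) a) - int (multiplicity (int p) b))"

definition padic_ints :: "nat \<Rightarrow> rat set" where
  "padic_ints p = {x. x = 0 \<or> padic_val p x \<ge> 0}"

definition padic_cong :: "nat \<Rightarrow> nat \<Rightarrow> rat \<Rightarrow> rat \<Rightarrow> bool" where
  "padic_cong p k x y \<longleftrightarrow> (\<exists>z \<in> padic_ints p. x - y = of_nat p ^ k * z)"

lemma padic_ints_iff:
  assumes "prime p"
  shows "x \<in> padic_ints p \<longleftrightarrow> \<not> int p dvd snd (quotient_of x)"
proof -
  obtain a b where q: "quotient_of x = (a, b)"
    by fastforce
  have b: "b > 0" and cop: "coprime a b"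
    using q by (auto intro: quotient_of_denom_pos quotient_of_coprime)
  have np: "\<not> is_unit (int p)"
    using assms prime_gt_1_nat by auto
  show ?thesis
  proof (cases "int p dvd b")
    case True
    then have na: "\<not> int p dvd a"
      using cop np by (meson coprime_common_divisor)
    have "multiplicity (int p) b > 0"
      using True b np by (simp add: multiplicity_gt_zero_iff)
    moreover have "x \<noteq> 0"
      using na q by (metis dvd_0_right fst_conv rat_zero_code)
    ultimately show ?thesis
      using na True q by (simp add: padic_ints_def padic_val_def not_dvd_imp_multiplicity_0)
  next
    case False
    then show ?thesis
      using q by (simp add: padic_ints_def padic_val_def not_dvd_imp_multiplicity_0)
  qed
qed

end

(*
  With u = a ^ (p - 1), which is 1 modulo p, we have 1 / u = 4 - 6 u + 4 u ^ 2 - u ^ 3 modulo p ^ 4,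
  so both harmonic numbers are combinations of power sums, and by Faulhaber's formula
  the sum of the m-th powers is p B_m + m (m - 1) / 6 * p ^ 3 B_(m - 2) modulo p ^ 4 for even m.
  What remains are Kummer congruences between Bernoulli numbers. They come from alternating sums:
  modulo p ^ r, the sum of (-1) ^ a * a ^ m over a < p ^ r is the value at 0 of the Euler polynomial,
  2 (1 - 2 ^ (m + 1)) B_(m + 1) / (m + 1), and, unlike for ordinary power sums, no power of p
  is lost by dividing by m + 1.
*)

theory Submission
  imports Defs "HOL-Number_Theory.Residues"
begin

section \<open>Exponential generating functions\<close>

text \<open>The two harmonic numbers need Kummer congruences of different depth. For H_(p-1,p-3) the
  exponents are 2, p + 1, 2 p and 3 p - 1, and B_(3p-1) is absent from the result. It enters the
  power sum with only one factor p, so it has to be expressed by the others modulo p ^ 3. The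
  indices are 2 + i (p - 1) for i = 0, ..., 3, so this is a statement about a third difference of
  B_m / m. The Euler factor 1 - p ^ (m - 1) is visible modulo p ^ 3 only at m = 2, where it gives (1
  - p) / 12. For H_(p-1,p-1) the exponents are multiples of p - 1. The numbers p B_m stay in the
  result, and only the B_(m-2) in the terms of order p ^ 3 must be compared, modulo p. The p ^ 3
  terms of the result cancel modulo p ^ 4, because p B_m is -1 modulo p and 13/3 = 19/2 - 7 + 11/6.
  The price of alternating sums is the factor 1 - 2 ^ m, which must be a unit. Modulo p it is -3 for
  the first family of indices and 3/4 for the second.\<close>

lemma fps_nth_egf_mult:
  fixes f g :: "nat \<Rightarrow> rat"
  shows "fps_nth (Abs_fps (\<lambda>n. f n / fact n) * Abs_fps (\<lambda>n. g n / fact n)) n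
           = (\<Sum>k\<le>n. of_nat (n choose k) * f k * g (n - k)) / fact n"
proof -
  have "f k / fact k * (g (n - k) / fact (n - k))
          = of_nat (n choose k) * f k * g (n - k) / fact n" if "k \<le> n" for k
    using that by (simp add: binomial_fact field_simps)
  then show ?thesis
    by (simp add: fps_mult_nth sum_divide_distrib atLeast0AtMost)
qed

lemma fps_exp_minus_1_nz: "fps_exp (1 :: rat) - 1 \<noteq> 0"
  by (auto simp: fps_eq_iff intro!: exI[of _ 1])

text \<open>Substitution of c x into the defining series. The value c = -1 yields the vanishing at
  odd indices, c = 2 the Euler values.\<close>

lemma bernoulli_fps_scaled:
  "Abs_fps (\<lambda>n. c ^ n * (bernoulli n / fact n)) * (fps_exp c - 1) = fps_const c * fps_X"
proof -
  have "(Abs_fps (\<lambda>n. bernoulli n / fact n) * (fps_exp 1 - 1)) oo (fps_const c * fps_X)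
          = fps_X oo (fps_const c * fps_X)"
    by (simp only: bernoulli_fps)
  then show ?thesis
    by (simp add: fps_compose_mult_distrib fps_compose_sub_distrib fps_exp_compose_linear)
       (simp add: fps_compose_linear)
qed

text \<open>Multiply the geometric sum (e^x - 1) (1 + e^x + ... + e^((n-1)x)) = e^(nx) - 1 by the
  Bernoulli series and compare coefficients. The usual denominator m + 1 is traded for k + 1, so
  that for n = p each term is governed by p ^ (k + 1) / (k + 1), whatever m is.\<close>

lemma power_sum_bernoulli:
  "(\<Sum>a<n. of_nat a ^ m :: rat)
     = (\<Sum>k\<le>m. of_nat (m choose k) * bernoulli (m - k) * of_nat n ^ (k + 1) / of_nat (k + 1))"
proof -
  let ?B = "Abs_fps (\<lambda>n. bernoulli n / fact n)"
  let ?S = "\<Sum>a<n. fps_exp (of_nat a :: rat)"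
  \<comment> \<open>The coefficients of e^(nx) - 1. Since \<open>g 0 = 0\<close>, the summand k = m
    + 1 drops out below.\<close>
  define g :: "nat \<Rightarrow> rat" where "g = (\<lambda>k. of_nat n ^ k - (if k = 0 then 1 else 0))"
  have "(fps_exp 1 - 1) * ?S = fps_exp (of_nat n) - 1"
    by (induction n) (simp_all add: algebra_simps flip: fps_exp_add_mult)
  then have "?B * (fps_exp 1 - 1) * ?S = ?B * (fps_exp (of_nat n) - 1)"
    by (simp add: mult.assoc)
  also have "fps_exp (of_nat n) - 1 = Abs_fps (\<lambda>k. g k / fact k)"
    by (auto simp: fps_eq_iff g_def)
  finally have "fps_nth (fps_X * ?S) (m + 1) = fps_nth (?B * Abs_fps (\<lambda>k. g k / fact k)) (m + 1)"
    by (simp add: bernoulli_fps)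
  also have "fps_nth (fps_X * ?S) (m + 1) = (\<Sum>a<n. of_nat a ^ m) / fact m"
    by (simp add: fps_sum_nth sum_divide_distrib)
  finally have "(\<Sum>a<n. of_nat a ^ m :: rat)
      = (\<Sum>k\<le>m + 1. of_nat ((m + 1) choose k) * bernoulli k * g (m + 1 - k)) / of_nat (m + 1)"
    unfolding fps_nth_egf_mult by (simp add: divide_eq_eq eq_divide_eq mult_ac del: sum.atMost_Suc)
  also have "(\<Sum>k\<le>m + 1. of_nat ((m + 1) choose k) * bernoulli k * g (m + 1 - k))
      = (\<Sum>k\<le>m. of_nat ((m + 1) choose k) * bernoulli k * of_nat n ^ (m + 1 - k))"
    by (auto simp: g_def intro!: sum.cong)
  also have "\<dots> = (\<Sum>k\<le>m. of_nat ((m + 1) choose (m - k)) * bernoulli (m - k) * of_nat n ^ (k + 1))"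
    by (rule sum.reindex_bij_witness[of _ "\<lambda>k. m - k" "\<lambda>k. m - k"]) (auto simp: Suc_diff_le)
  finally have *: "(\<Sum>a<n. of_nat a ^ m :: rat)
      = (\<Sum>k\<le>m. of_nat ((m + 1) choose (m - k)) * bernoulli (m - k) * of_nat n ^ (k + 1) / of_nat (m + 1))"
    by (simp add: sum_divide_distrib)
  have "of_nat ((m + 1) choose (m - k)) / of_nat (m + 1) = (of_nat (m choose k) / of_nat (k + 1) :: rat)"
    if "k \<le> m" for k
  proof -
    have "(m + 1) choose (m - k) = Suc m choose Suc k"
      using that binomial_symmetric[of "Suc k" "Suc m"] by simp
    moreover have "of_nat (Suc k) * of_nat (Suc m choose Suc k) = (of_nat (Suc m) * of_nat (m choose k) :: rat)"
      by (simp only: Suc_times_binomial_eq mult.commute flip: of_nat_mult)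
    ultimately show ?thesis
      by (simp add: divide_eq_eq eq_divide_eq mult_ac del: of_nat_Suc binomial_Suc_Suc)
  qed
  then have "of_nat ((m + 1) choose (m - k)) / of_nat (m + 1) * (bernoulli (m - k) * of_nat n ^ (k + 1))
      = of_nat (m choose k) / of_nat (k + 1) * (bernoulli (m - k) * of_nat n ^ (k + 1))"
    if "k \<le> m" for k
    using that by (simp only:)
  then show ?thesis
    unfolding * by (intro sum.cong refl) (simp only: times_divide_eq_left mult.assoc atMost_iff)
qed

text \<open>The Bernoulli series satisfies B(-x) = B(x) + x, so its only odd coefficient is the
  linear one.\<close>

lemma bernoulli_odd_eq_0:
  assumes "odd n" "n > 1"
  shows "bernoulli n = 0"
proof -
  let ?B = "Abs_fps (\<lambda>n. bernoulli n / fact n)"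
  let ?C = "Abs_fps (\<lambda>n. (-1) ^ n * (bernoulli n / fact n))"
  have e: "fps_exp (-1) * fps_exp (1 :: rat) = 1"
    by (simp flip: fps_exp_add_mult)
  have "?C * (fps_exp (-1) - 1) * fps_exp 1 = - fps_X * fps_exp 1"
    by (simp only: bernoulli_fps_scaled flip: fps_const_neg) simp
  then have "?C * (fps_exp 1 - 1) = fps_X * fps_exp 1"
    using mult.assoc[of ?C "fps_exp (-1)" "fps_exp 1"] unfolding e
    by (simp add: left_diff_distrib right_diff_distrib diff_eq_eq)
  then have "(?C - fps_X - ?B) * (fps_exp 1 - 1) = 0"
    unfolding left_diff_distrib[of _ _ "fps_exp 1 - 1"] bernoulli_fps by (simp add: algebra_simps)
  then have "?C - fps_X - ?B = 0"
    using fps_exp_minus_1_nz by (simp only: mult_eq_0_iff) simp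
  then have "fps_nth (?C - fps_X - ?B) n = 0"
    by (simp only: fps_zero_nth)
  then show ?thesis
    using assms by (simp add: fps_X_def)
qed

text \<open>The values at \<open>0\<close> of the Euler polynomials.\<close>

definition euler_zero :: "nat \<Rightarrow> rat" where
  "euler_zero m = 2 * (1 - 2 ^ (m + 1)) * divided_bernoulli (m + 1)"

text \<open>This is 1 / (e^x - 1) - 2 / (e^(2x) - 1) = 1 / (e^x + 1), multiplied by 2 x. The proof
  clears denominators and cancels x (e^x - 1).\<close>

lemma euler_zero_fps:
  "Abs_fps (\<lambda>n. euler_zero n / fact n) * (fps_exp 1 + 1) = 2"
proof -
  let ?B = "Abs_fps (\<lambda>n. bernoulli n / fact n)"
  let ?C = "Abs_fps (\<lambda>n. 2 ^ n * (bernoulli n / fact n))"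
  let ?E = "Abs_fps (\<lambda>n. euler_zero n / fact n)"
  have e: "fps_exp (2 :: rat) = fps_exp 1 * fps_exp 1"
    by (simp flip: fps_exp_add_mult)
  have XE: "fps_X * ?E = 2 * (?B - ?C)"
  proof (rule fps_ext)
    fix n
    show "fps_nth (fps_X * ?E) n = fps_nth (2 * (?B - ?C)) n"
      by (cases n) (simp_all add: numeral_fps_const fps_const_sub euler_zero_def divided_bernoulli_def field_simps
          flip: of_nat_Suc)
  qed
  have "(fps_X * (fps_exp 1 - 1)) * (?E * (fps_exp 1 + 1))
          = (fps_X * ?E) * ((fps_exp 1 - 1) * (fps_exp 1 + 1))"
    by (simp only: mult_ac)
  also have "\<dots> = 2 * (?B * (fps_exp 1 - 1) * (fps_exp 1 + 1) - ?C * (fps_exp 2 - 1))"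
    unfolding XE e by (simp add: algebra_simps)
  also have "\<dots> = (fps_X * (fps_exp 1 - 1)) * 2"
    unfolding bernoulli_fps bernoulli_fps_scaled
    by (simp add: algebra_simps numeral_fps_const)
  finally show ?thesis
    using fps_exp_minus_1_nz by simp
qed

lemma euler_zero_0: "euler_zero 0 = 1"
proof -
  have "fps_nth (Abs_fps (\<lambda>n. euler_zero n / fact n) * (fps_exp 1 + 1)) 0 = 2"
    by (simp only: euler_zero_fps) simp
  then show ?thesis by simp
qed

text \<open>The only division in this recursion is by 2, which makes the values integral at every
  odd prime.\<close>

lemma euler_zero_rec:
  assumes "m > 0"
  shows "2 * euler_zero m = - (\<Sum>k<m. of_nat (m choose k) * euler_zero k)"
proof -
  define g :: "nat \<Rightarrow> rat" where "g = (\<lambda>k. if k = 0 then 2 else 1)"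
  have g: "fps_exp 1 + 1 = Abs_fps (\<lambda>k. g k / fact k)"
    by (auto simp: fps_eq_iff g_def)
  have "fps_nth (Abs_fps (\<lambda>n. euler_zero n / fact n) * Abs_fps (\<lambda>k. g k / fact k)) m = fps_nth 2 m"
    by (simp only: euler_zero_fps flip: g)
  then have "(\<Sum>k\<le>m. of_nat (m choose k) * euler_zero k * g (m - k)) = 0"
    unfolding fps_nth_egf_mult using assms by (simp add: numeral_fps_const)
  moreover have "{..m} = insert m {..<m}"
    by auto
  moreover have "(\<Sum>k<m. of_nat (m choose k) * euler_zero k * g (m - k))
                   = (\<Sum>k<m. of_nat (m choose k) * euler_zero k)"
    by (auto simp: g_def intro!: sum.cong)
  ultimately show ?thesis
    by (simp add: g_def)
qed

text \<open>The alternating geometric sum gives 1 - (-1)^n e^(nx), and oddness of n turns this into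
  1 + e^(nx). Every correction term carries a positive power of n and no denominator.\<close>

lemma alternating_power_sum_euler:
  assumes "odd n"
  shows "2 * (\<Sum>a<n. (-1) ^ a * of_nat a ^ m)
           = 2 * euler_zero m
             + (\<Sum>k<m. of_nat (m choose k) * euler_zero k * of_nat n ^ (m - k))"
proof -
  let ?E = "Abs_fps (\<lambda>n. euler_zero n / fact n)"
  let ?S = "\<lambda>n. \<Sum>a<n. (-1) ^ a * fps_exp (of_nat a :: rat)"
  \<comment> \<open>The coefficients of e^(nx) + 1. The value \<open>g 0 = 2\<close> doubles the
    summand k = m.\<close>
  define g :: "nat \<Rightarrow> rat" where "g = (\<lambda>k. of_nat n ^ k + (if k = 0 then 1 else 0))"
  have "(fps_exp 1 + 1) * ?S n = 1 - (-1) ^ n * fps_exp (of_nat n)"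
  proof (induction n)
    case (Suc n)
    have "fps_exp (of_nat (Suc n) :: rat) = fps_exp 1 * fps_exp (of_nat n)"
      by (simp flip: fps_exp_add_mult)
    with Suc show ?case
      by (simp add: algebra_simps)
  qed simp
  also have "\<dots> = Abs_fps (\<lambda>k. g k / fact k)"
    using assms by (auto simp: fps_eq_iff g_def)
  finally have "?E * (fps_exp 1 + 1) * ?S n = ?E * Abs_fps (\<lambda>k. g k / fact k)"
    by (simp add: mult.assoc)
  then have "fps_nth (2 * ?S n) m = fps_nth (?E * Abs_fps (\<lambda>k. g k / fact k)) m"
    by (simp only: euler_zero_fps)
  moreover have "fps_nth ((-1) ^ a * fps_exp (of_nat a :: rat)) m = (-1) ^ a * (of_nat a ^ m / fact m)" for a
    by (cases "even a") auto
  ultimately have "2 * (\<Sum>a<n. (-1) ^ a * (of_nat a ^ m / fact m))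
      = (\<Sum>k\<le>m. of_nat (m choose k) * euler_zero k * g (m - k)) / fact m"
    unfolding fps_nth_egf_mult by (simp add: numeral_fps_const fps_sum_nth)
  then have "2 * (\<Sum>a<n. (-1) ^ a * of_nat a ^ m)
      = (\<Sum>k\<le>m. of_nat (m choose k) * euler_zero k * g (m - k))"
    by (simp add: field_simps flip: sum_divide_distrib)
  moreover have "{..m} = insert m {..<m}"
    by auto
  moreover have "(\<Sum>k<m. of_nat (m choose k) * euler_zero k * g (m - k))
                   = (\<Sum>k<m. of_nat (m choose k) * euler_zero k * of_nat n ^ (m - k))"
    by (auto simp: g_def intro!: sum.cong)
  ultimately show ?thesis
    by (simp add: g_def)
qed


section \<open>Integrality and congruences at a prime\<close>

context
  fixes p :: nat
  assumes p: "prime p"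
begin

section \<open>Arithmetic of p-integral rationals\<close>

text \<open>Fractions need not be reduced here, so closure under sums and products requires no
  normalisation.\<close>

lemma padic_ints_iff_fraction:
  "x \<in> padic_ints p \<longleftrightarrow> (\<exists>a b. \<not> int p dvd b \<and> x = of_int a / of_int b)"
proof
  assume "x \<in> padic_ints p"
  then show "\<exists>a b. \<not> int p dvd b \<and> x = of_int a / of_int b"
    using quotient_of_div[of x] by (metis padic_ints_iff[OF p] prod.collapse)
next
  assume "\<exists>a b. \<not> int p dvd b \<and> x = of_int a / of_int b"
  then obtain a b where ab: "\<not> int p dvd b" "x = of_int a / of_int b"
    by blast
  obtain c d where q: "quotient_of x = (c, d)"
    by fastforce
  have x: "x = of_int c / of_int d" and d: "d > 0" and cd: "coprime c d"
    using q by (auto intro: quotient_of_div quotient_of_denom_pos quotient_of_coprime)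
  have "b \<noteq> 0"
    using ab by auto
  then have "of_int (c * b) = (of_int (a * d) :: rat)"
    using d x ab by (simp add: field_simps)
  then have "c * b = a * d"
    by (simp only: of_int_eq_iff)
  then have "d dvd b"
    using cd by (metis coprime_commute coprime_dvd_mult_right_iff dvd_triv_right)
  then show "x \<in> padic_ints p"
    using ab q by (auto simp: padic_ints_iff[OF p] dest: dvd_trans)
qed

lemma padic_ints_add [simp, intro]:
  assumes "x \<in> padic_ints p" "y \<in> padic_ints p"
  shows "x + y \<in> padic_ints p"
proof -
  obtain a b c d where "\<not> int p dvd b" "x = of_int a / of_int b" "\<not> int p dvd d" "y = of_int c / of_int d"
    using assms by (auto simp: padic_ints_iff_fraction)
  moreover from this have "x + y = of_int (a * d + c * b) / of_int (b * d)"
    by (cases "b = 0"; cases "d = 0") (auto simp: add_frac_eq)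
  ultimately show ?thesis
    using p by (metis padic_ints_iff_fraction prime_dvd_mult_iff prime_int_nat_transfer nat_int
        prime_nat_int_transfer)
qed

lemma padic_ints_mult [simp, intro]:
  assumes "x \<in> padic_ints p" "y \<in> padic_ints p"
  shows "x * y \<in> padic_ints p"
proof -
  obtain a b c d where "\<not> int p dvd b" "x = of_int a / of_int b" "\<not> int p dvd d" "y = of_int c / of_int d"
    using assms by (auto simp: padic_ints_iff_fraction)
  moreover from this have "x * y = of_int (a * c) / of_int (b * d)"
    by simp
  ultimately show ?thesis
    using p by (metis padic_ints_iff_fraction prime_dvd_mult_iff prime_int_nat_transfer nat_int
        prime_nat_int_transfer)
qed

lemma padic_ints_of_int [simp, intro]: "of_int a \<in> padic_ints p"
  unfolding padic_ints_iff_fraction using prime_gt_1_nat[OF p]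
  by (intro exI[of _ a] exI[of _ 1]) auto

lemma padic_ints_of_nat [simp, intro]: "of_nat a \<in> padic_ints p"
  using padic_ints_of_int[of "int a"] by simp

lemma padic_ints_numeral [simp, intro]: "numeral a \<in> padic_ints p"
  using padic_ints_of_int[of "numeral a"] by simp

lemma padic_ints_0_1 [simp, intro]: "0 \<in> padic_ints p" "1 \<in> padic_ints p"
  using padic_ints_of_int[of 0] padic_ints_of_int[of 1] by simp_all

lemma padic_ints_minus [simp, intro]: "x \<in> padic_ints p \<Longrightarrow> - x \<in> padic_ints p"
  using padic_ints_mult[OF padic_ints_of_int[of "-1"]] by simp

lemma padic_ints_diff [simp, intro]:
  "x \<in> padic_ints p \<Longrightarrow> y \<in> padic_ints p \<Longrightarrow> x - y \<in> padic_ints p"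
  using padic_ints_add[of x "- y"] by simp

lemma padic_ints_power [simp, intro]: "x \<in> padic_ints p \<Longrightarrow> x ^ n \<in> padic_ints p"
  by (induction n) auto

lemma padic_ints_sum: "(\<And>i. i \<in> A \<Longrightarrow> f i \<in> padic_ints p) \<Longrightarrow> sum f A \<in> padic_ints p"
  by (induction A rule: infinite_finite_induct) auto

lemma padic_ints_inverse_of_int:
  "\<not> int p dvd a \<Longrightarrow> 1 / of_int a \<in> padic_ints p"
  unfolding padic_ints_iff_fraction by (intro exI[of _ 1] exI[of _ a]) auto

lemma padic_ints_inverse_of_nat:
  "\<not> p dvd a \<Longrightarrow> 1 / of_nat a \<in> padic_ints p"
  using padic_ints_inverse_of_int[of "int a"] by simp

lemma padic_ints_inverse_unit:
  assumes "\<not> int p dvd a" "x \<in> padic_ints p"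
  shows "1 / (of_int a + of_nat p * x) \<in> padic_ints p"
proof -
  obtain c d where cd: "\<not> int p dvd d" "x = of_int c / of_int d"
    using assms by (auto simp: padic_ints_iff_fraction)
  then have d: "d \<noteq> 0"
    by auto
  have "\<not> int p dvd a * d"
    using assms cd p by (simp add: prime_dvd_mult_iff)
  then have "\<not> int p dvd a * d + int p * c"
    by (simp add: dvd_add_left_iff)
  moreover have "1 / (of_int a + of_nat p * x) = of_int d / of_int (a * d + int p * c)"
    using d by (simp add: cd field_simps)
  ultimately show ?thesis
    unfolding padic_ints_iff_fraction by blast
qed

text \<open>A positive number below p ^ (k + 1) contains at most k factors p. This controls the
  denominators in Faulhaber's formula.\<close>

lemma padic_ints_power_div:
  assumes "n > 0" "n < p ^ (k + 1)"
  shows "of_nat p ^ k / of_nat n \<in> padic_ints p"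
proof -
  define v where "v = multiplicity p n"
  obtain m where m: "n = p ^ v * m" "\<not> p dvd m"
    using assms prime_gt_1_nat[OF p] unfolding v_def
    by (metis multiplicity_decompose' nat_dvd_1_iff_1 nat_neq_iff)
  have "p ^ v \<le> n"
    using m assms by (cases m) auto
  then have "p ^ v < p ^ (k + 1)"
    using assms by linarith
  then have "v \<le> k"
    using prime_gt_1_nat[OF p] by (simp add: power_strict_increasing_iff del: power_Suc)
  then have "(of_nat p :: rat) ^ k = of_nat p ^ v * of_nat p ^ (k - v)"
    by (simp flip: power_add)
  then have "of_nat p ^ k / of_nat n = of_nat p ^ (k - v) * (1 / of_nat m :: rat)"
    using prime_gt_0_nat[OF p] by (simp add: m)
  then show ?thesis
    using padic_ints_mult[OF padic_ints_power[OF padic_ints_of_nat] padic_ints_inverse_of_nat[OF m(2)]]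
    by (simp only:)
qed

section \<open>Congruences modulo p ^ k\<close>

lemma padic_congI:
  "z \<in> padic_ints p \<Longrightarrow> x = y + of_nat p ^ k * z \<Longrightarrow> padic_cong p k x y"
  by (auto simp: padic_cong_def)

lemma padic_congE:
  assumes "padic_cong p k x y"
  obtains z where "z \<in> padic_ints p" "x = y + of_nat p ^ k * z"
  using assms by (auto simp: padic_cong_def algebra_simps)

lemma padic_cong_refl [simp]: "padic_cong p k x x"
  by (rule padic_congI[of 0]) auto

lemma padic_cong_sym: "padic_cong p k x y \<Longrightarrow> padic_cong p k y x"
  by (elim padic_congE, rule padic_congI[of "- z" for z]) auto

lemma padic_cong_add:
  assumes "padic_cong p k x y" "padic_cong p k x' y'"
  shows "padic_cong p k (x + x') (y + y')"
proof -
  obtain z z' where "z \<in> padic_ints p" "z' \<in> padic_ints p"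
    "x = y + of_nat p ^ k * z" "x' = y' + of_nat p ^ k * z'"
    using assms by (metis padic_congE)
  then show ?thesis
    by (intro padic_congI[of "z + z'"]) (auto simp: algebra_simps)
qed

lemma padic_cong_mult_left:
  assumes "c \<in> padic_ints p" "padic_cong p k x y"
  shows "padic_cong p k (c * x) (c * y)"
proof -
  obtain z where "z \<in> padic_ints p" "x = y + of_nat p ^ k * z"
    using assms by (metis padic_congE)
  then show ?thesis
    using assms by (intro padic_congI[of "c * z"]) (auto simp: algebra_simps)
qed

lemma padic_cong_diff:
  assumes "padic_cong p k x y" "padic_cong p k x' y'"
  shows "padic_cong p k (x - x') (y - y')"
  using padic_cong_add[OF assms(1) padic_cong_mult_left[OF padic_ints_of_int[of "-1"] assms(2)]] by simp

lemma padic_cong_trans [trans]: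
  assumes "padic_cong p k x y" "padic_cong p k y z"
  shows "padic_cong p k x z"
  using padic_cong_add[OF assms] by (simp add: padic_cong_def)

lemma padic_cong_sum:
  "(\<And>i. i \<in> A \<Longrightarrow> padic_cong p k (f i) (g i)) \<Longrightarrow> padic_cong p k (sum f A) (sum g A)"
  by (induction A rule: infinite_finite_induct) (auto intro: padic_cong_add)

lemma padic_cong_mono:
  assumes "padic_cong p k x y" "j \<le> k"
  shows "padic_cong p j x y"
proof -
  obtain z where "z \<in> padic_ints p" "x = y + of_nat p ^ k * z"
    using assms by (metis padic_congE)
  moreover have "(of_nat p :: rat) ^ k = of_nat p ^ j * of_nat p ^ (k - j)"
    using assms by (simp flip: power_add)
  ultimately show ?thesis
    by (intro padic_congI[of "of_nat p ^ (k - j) * z"]) auto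
qed

section \<open>Fermat's little theorem\<close>

lemma fermat_rat:
  assumes "\<not> p dvd a"
  obtains w where "w \<in> padic_ints p" "(of_nat a :: rat) ^ (p - 1) = 1 + of_nat p * w"
proof -
  have "[int (a ^ (p - 1)) = int 1] (mod int p)"
    using fermat_theorem[OF p assms] by (simp only: cong_int_iff)
  then obtain k where "int (a ^ (p - 1)) - 1 = int p * k"
    by (auto simp: cong_iff_dvd_diff elim: dvdE)
  then have "int (a ^ (p - 1)) = 1 + int p * k"
    by simp
  then have "(of_int (int (a ^ (p - 1))) :: rat) = of_int (1 + int p * k)"
    by (simp only:)
  then show ?thesis
    by (intro that[of "of_int k"]) auto
qed

lemma padic_cong_of_int:
  assumes "[x = y] (mod int p ^ k)"
  shows "padic_cong p k (of_int x) (of_int y)"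
proof -
  obtain c where "x - y = int p ^ k * c"
    using assms by (auto simp: cong_iff_dvd_diff elim: dvdE)
  then have "x = y + int p ^ k * c"
    by simp
  then show ?thesis
    by (intro padic_congI[of "of_int c"]) auto
qed

lemma fermat_cong_int:
  assumes "m > 0"
  shows "[int a ^ (m + i * (p - 1)) = int a ^ m] (mod int p)"
proof (cases "p dvd a")
  case True
  then have "int p dvd int a ^ (m + i * (p - 1))" "int p dvd int a ^ m"
    using assms by (auto intro: dvd_power_le dvd_trans[OF _ dvd_power])
  then show ?thesis
    by (simp add: cong_iff_dvd_diff)
next
  case False
  have "[int (a ^ (p - 1)) = int 1] (mod int p)"
    using fermat_theorem[OF p False] by (simp only: cong_int_iff)
  then have "[(int a ^ (p - 1)) ^ i = 1 ^ i] (mod int p)"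
    by (intro cong_pow) simp
  then have "[int a ^ m * (int a ^ (p - 1)) ^ i = int a ^ m * 1] (mod int p)"
    by (intro cong_mult) auto
  then show ?thesis
    by (simp add: power_add power_mult mult.commute[of i])
qed

section \<open>Power sums modulo p ^ 4\<close>

text \<open>The part of von Staudt's theorem saying that p divides the denominator of B_m at most
  once. In Faulhaber's formula for n = p the term k = 0 is p B_m, and the others are integral
  multiples of p B_(m-k) times p ^ k / (k + 1), so induction applies.\<close>

lemma p_bernoulli_in_padic_ints: "of_nat p * bernoulli m \<in> padic_ints p"
proof (induction m rule: less_induct)
  case (less m)
  define f :: "nat \<Rightarrow> rat" where
    "f k = of_nat (m choose k) * bernoulli (m - k) * of_nat p ^ (k + 1) / of_nat (k + 1)" for k
  have "f k \<in> padic_ints p" if "k \<in> {1..m}" for k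
  proof -
    have "of_nat p ^ k / of_nat (k + 1) \<in> padic_ints p"
      using power_gt_expt[OF prime_gt_1_nat[OF p, unfolded One_nat_def], of "k + 1"] by (intro padic_ints_power_div) auto
    moreover have "of_nat p * bernoulli (m - k) \<in> padic_ints p"
      using that by (intro less) auto
    ultimately have "of_nat (m choose k) * (of_nat p * bernoulli (m - k))
        * (of_nat p ^ k / of_nat (k + 1)) \<in> padic_ints p"
      by (metis padic_ints_mult padic_ints_of_nat)
    then show ?thesis
      by (simp add: f_def mult_ac)
  qed
  then have "sum f {1..m} \<in> padic_ints p"
    by (rule padic_ints_sum)
  moreover have "{..m} = insert 0 {1..m}"
    by auto
  then have "(\<Sum>a<p. of_nat a ^ m) = of_nat p * bernoulli m + sum f {1..m}"
    unfolding power_sum_bernoulli by (simp add: f_def)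
  then have "of_nat p * bernoulli m = (\<Sum>a<p. of_nat a ^ m) - sum f {1..m}"
    by simp
  ultimately show ?case
    by (auto intro!: padic_ints_sum)
qed

lemma power_sum_cong:
  assumes "p > 5" "even m" "m \<ge> 6"
  shows "padic_cong p 4 (\<Sum>a=1..p-1. of_nat a ^ m)
           (of_nat p * bernoulli m
            + of_nat m * (of_nat m - 1) / 6 * of_nat p ^ 2 * (of_nat p * bernoulli (m - 2)))"
proof -
  define f :: "nat \<Rightarrow> rat" where
    "f k = of_nat (m choose k) * bernoulli (m - k) * of_nat p ^ (k + 1) / of_nat (k + 1)" for k
  define g :: "nat \<Rightarrow> rat" where
    "g k = of_nat (m choose k) * (of_nat p * bernoulli (m - k)) * (of_nat p ^ (k - 4) / of_nat (k + 1))" for k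
  have "g k \<in> padic_ints p" if "k \<in> {4..m}" for k
  proof -
    \<comment> \<open>With i = k - 4 this keeps the denominator k + 1 below p ^ (k - 3). At i = 0 it
      reads 5 < p.\<close>
    have "i + 5 < p ^ (i + 1)" for i
    proof (induction i)
      case (Suc i)
      have "Suc i + 5 \<le> p ^ (i + 1) * 1"
        using Suc by simp
      also have "\<dots> < p ^ (i + 1) * p"
        using prime_gt_1_nat[OF p] by (intro mult_strict_left_mono) auto
      finally show ?case
        by (simp add: mult_ac)
    qed (use assms in auto)
    from this[of "k - 4"] have "of_nat p ^ (k - 4) / of_nat (k + 1) \<in> padic_ints p"
      using that by (intro padic_ints_power_div) auto
    then show ?thesis
      unfolding g_def by (metis padic_ints_mult padic_ints_of_nat p_bernoulli_in_padic_ints)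
  qed
  then have int: "sum g {4..m} \<in> padic_ints p"
    by (rule padic_ints_sum)
  have "f k = of_nat p ^ 4 * g k" if "k \<in> {4..m}" for k
  proof -
    have "(of_nat p :: rat) ^ (k + 1) = of_nat p ^ 4 * (of_nat p * of_nat p ^ (k - 4))"
      using that by (simp flip: power_add power_Suc)
    then show ?thesis
      by (simp only: f_def g_def) (simp add: mult_ac)
  qed
  then have rest: "sum f {4..m} = of_nat p ^ 4 * sum g {4..m}"
    by (simp add: sum_distrib_left)
  \<comment> \<open>The bound on m keeps m - 3 above 1; B_1 = -1/2 would survive.\<close>
  have "bernoulli (m - 1) = 0" "bernoulli (m - 3) = 0"
    using assms by (auto intro!: bernoulli_odd_eq_0)
  then have "f 1 = 0" "f 3 = 0"
    by (auto simp: f_def)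
  moreover have "f 2 = of_nat m * (of_nat m - 1) / 6 * of_nat p ^ 2 * (of_nat p * bernoulli (m - 2))"
  proof -
    have "2 * (m choose 2) = m * (m - 1)"
      unfolding choose_two using assms by simp
    then have "of_nat (2 * (m choose 2)) = (of_nat (m * (m - 1)) :: rat)"
      by (simp only:)
    then have "of_nat (m choose 2) = (of_nat m * (of_nat m - 1) / 2 :: rat)"
      using assms by (simp add: of_nat_diff)
    then show ?thesis
      by (simp only: f_def) (simp add: eval_nat_numeral)
  qed
  moreover have "{..m} = {0, 1, 2, 3} \<union> {4..m}"
    using assms by auto
  then have "sum f {..m} = f 0 + f 1 + f 2 + f 3 + sum f {4..m}"
    by (simp add: sum.union_disjoint)
  moreover have "(\<Sum>a=1..p-1. of_nat a ^ m) = sum f {..m}"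
  proof -
    have "{..<p} = insert 0 {1..p-1}"
      using prime_gt_0_nat[OF p] by auto
    then show ?thesis
      using power_sum_bernoulli[where n = p and m = m] assms by (simp add: f_def power_0_left)
  qed
  ultimately show ?thesis
    using int rest by (intro padic_congI[of "sum g {4..m}"]) (auto simp: f_def[of 0])
qed

text \<open>Meant for n = 2 and n = 0, where the summands on the left are 1 / a ^ (p - 3) and 1 / a
  ^ (p - 1).\<close>

lemma power_sum_quotient_cong:
  "padic_cong p 4 (\<Sum>a=1..p-1. of_nat a ^ n / of_nat a ^ (p - 1))
     (4 * (\<Sum>a=1..p-1. of_nat a ^ n) - 6 * (\<Sum>a=1..p-1. of_nat a ^ (n + (p - 1)))
      + 4 * (\<Sum>a=1..p-1. of_nat a ^ (n + 2 * (p - 1))) - (\<Sum>a=1..p-1. of_nat a ^ (n + 3 * (p - 1))))"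
proof -
  have "padic_cong p 4 (of_nat a ^ n / of_nat a ^ (p - 1))
     (4 * of_nat a ^ n - 6 * of_nat a ^ (n + (p - 1))
      + 4 * of_nat a ^ (n + 2 * (p - 1)) - of_nat a ^ (n + 3 * (p - 1)))" if a: "a \<in> {1..p-1}" for a
  proof -
    define u :: rat where "u = of_nat a ^ (p - 1)"
    have "\<not> p dvd a"
      using a by (auto dest: dvd_imp_le)
    then obtain w where w: "w \<in> padic_ints p" "u = 1 + of_nat p * w"
      unfolding u_def using fermat_rat by metis
    have u0: "u \<noteq> 0"
      using a by (simp add: u_def)
    have "\<not> int p dvd 1"
      using prime_gt_1_nat[OF p] by simp
    then have "1 / u \<in> padic_ints p"
      using padic_ints_inverse_unit[of 1 w] w by simp
    \<comment> \<open>The remainder is exactly (u - 1) ^ 4 / u, from the binomial expansion of (u -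
      1) ^ 4; it is divisible by p ^ 4 because p divides u - 1.\<close>
    moreover have "of_nat a ^ n / u = 4 * of_nat a ^ n - 6 * (of_nat a ^ n * u)
      + 4 * (of_nat a ^ n * u ^ 2) - (of_nat a ^ n * u ^ 3) + of_nat a ^ n * ((u - 1) ^ 4 * (1 / u))"
      using u0 by (simp add: field_simps eval_nat_numeral)
    moreover have "(u - 1) ^ 4 = of_nat p ^ 4 * w ^ 4"
      by (simp add: w power_mult_distrib)
    moreover have "of_nat a ^ (n + i * (p - 1)) = of_nat a ^ n * u ^ i" for i
      by (simp add: u_def power_add power_mult mult.commute[of i])
    from this[of 1] this[of 2] this[of 3]
    have "of_nat a ^ (n + (p - 1)) = of_nat a ^ n * u" "of_nat a ^ (n + 2 * (p - 1)) = of_nat a ^ n * u ^ 2"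
      "of_nat a ^ (n + 3 * (p - 1)) = of_nat a ^ n * u ^ 3"
      by simp_all
    ultimately show ?thesis
      using w unfolding u_def[symmetric]
      by (intro padic_congI[of "of_nat a ^ n * w ^ 4 * (1 / u)"]) (simp_all only: padic_ints_mult
            padic_ints_power padic_ints_of_nat mult_ac)
  qed
  from padic_cong_sum[OF this] show ?thesis
    by (simp only: sum.distrib sum_subtractf sum_distrib_left)
qed

section \<open>Integrality and congruences of the Euler values\<close>

lemma euler_zero_in_padic_ints:
  assumes "p > 2"
  shows "euler_zero m \<in> padic_ints p"
proof (induction m rule: less_induct)
  case (less m)
  have half: "1 / of_nat 2 \<in> padic_ints p"
    using assms by (intro padic_ints_inverse_of_nat) (auto dest: dvd_imp_le)
  show ?case
  proof (cases "m = 0")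
    case False
    have "(\<Sum>k<m. of_nat (m choose k) * euler_zero k) \<in> padic_ints p"
      using less by (auto intro!: padic_ints_sum)
    then have "- (1 / of_nat 2 * (\<Sum>k<m. of_nat (m choose k) * euler_zero k)) \<in> padic_ints p"
      using half by (intro padic_ints_minus padic_ints_mult)
    moreover have "euler_zero m = - (1 / of_nat 2 * (\<Sum>k<m. of_nat (m choose k) * euler_zero k))"
      using euler_zero_rec[of m] False by simp
    ultimately show ?thesis
      by (simp only:)
  qed (simp add: euler_zero_0)
qed

lemma alternating_power_sum_cong:
  assumes "p > 2"
  shows "padic_cong p r (\<Sum>a<p ^ r. (-1) ^ a * of_nat a ^ m) (euler_zero m)"
proof -
  let ?g = "\<lambda>k. of_nat (m choose k) * euler_zero k * of_nat (p ^ r) ^ (m - k - 1)"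
  have half: "1 / of_nat 2 \<in> padic_ints p"
    using assms by (intro padic_ints_inverse_of_nat) (auto dest: dvd_imp_le)
  have "sum ?g {..<m} \<in> padic_ints p"
    using euler_zero_in_padic_ints[OF assms] by (auto intro!: padic_ints_sum)
  then have "1 / of_nat 2 * sum ?g {..<m} \<in> padic_ints p"
    using half by blast
  moreover have "odd (p ^ r)"
    using assms p by (simp add: prime_odd_nat)
  note alternating_power_sum_euler[OF this, of m]
  moreover have "(of_nat (p ^ r) :: rat) ^ (m - k) = of_nat p ^ r * of_nat (p ^ r) ^ (m - k - 1)"
    if "k < m" for k
    using that by (cases "m - k") auto
  then have "(\<Sum>k<m. of_nat (m choose k) * euler_zero k * of_nat (p ^ r) ^ (m - k))
      = of_nat p ^ r * sum ?g {..<m}"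
    unfolding sum_distrib_left by (intro sum.cong refl) (simp only: lessThan_iff mult_ac)
  ultimately show ?thesis
    by (intro padic_congI[of "1 / of_nat 2 * sum ?g {..<m}"]) auto
qed

text \<open>By Fermat the alternating sums over a < p agree termwise; m > 0 covers the multiples of
  p.\<close>

lemma euler_zero_cong:
  assumes "p > 2" "m > 0"
  shows "padic_cong p 1 (euler_zero (m + i * (p - 1))) (euler_zero m)"
proof -
  have "padic_cong p 1 ((-1) ^ a * of_nat a ^ (m + i * (p - 1))) ((-1) ^ a * of_nat a ^ m)" for a
  proof -
    have "padic_cong p 1 (of_int (int a ^ (m + i * (p - 1)))) (of_int (int a ^ m))"
      using fermat_cong_int[OF assms(2), of a i] by (intro padic_cong_of_int) simp
    then show ?thesis
      using padic_cong_mult_left[OF padic_ints_of_int[of "(-1) ^ a"]] by simp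
  qed
  from padic_cong_sum[OF this]
  have "padic_cong p 1 (\<Sum>a<p ^ 1. (-1) ^ a * of_nat a ^ (m + i * (p - 1))) (\<Sum>a<p ^ 1. (-1) ^ a * of_nat a ^ m)" .
  then show ?thesis
    using alternating_power_sum_cong[OF assms(1), of 1] by (meson padic_cong_sym padic_cong_trans)
qed

text \<open>
  The factor \<open>x (1 - x ^ (p - 1)) ^ r\<close> is divisible by \<open>p ^ r\<close> unless \<open>p\<close> divides \<open>x\<close>; the
  multiples of \<open>p\<close> contribute the Euler factor on the right.
\<close>

lemma euler_zero_difference_cong:
  assumes "p > 3" "r \<le> 3"
  shows "padic_cong p r (\<Sum>i\<le>r. of_nat (r choose i) * (-1) ^ i * euler_zero (1 + i * (p - 1)))
           (of_nat p * euler_zero 1)"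
proof -
  have p2: "p > 2"
    using assms by simp
  have single: "padic_cong p r ((-1) ^ a * (of_nat a * (1 - of_nat a ^ (p - 1)) ^ r))
          ((-1) ^ a * (if p dvd a then of_nat a else 0))" for a
  proof -
    have "[int a * (1 - int a ^ (p - 1)) ^ r = (if p dvd a then int a else 0)] (mod int p ^ r)"
    proof (cases "p dvd a")
      case True
      \<comment> \<open>A multiple of p is raised to the power p - 1, which is at least r.\<close>
      then have "int p ^ r dvd int a ^ (p - 1)"
        using assms by (intro dvd_power_le) auto
      then have "[1 - int a ^ (p - 1) = 1] (mod int p ^ r)"
        by (simp add: cong_iff_dvd_diff)
      then have "[int a * (1 - int a ^ (p - 1)) ^ r = int a * 1 ^ r] (mod int p ^ r)"
        by (intro cong_mult cong_pow cong_refl)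
      with True show ?thesis
        by simp
    next
      case False
      have "[int (a ^ (p - 1)) = int 1] (mod int p)"
        using fermat_theorem[OF p False] by (simp only: cong_int_iff)
      then have "int p dvd 1 - int a ^ (p - 1)"
        by (metis cong_iff_dvd_diff cong_sym of_nat_1 of_nat_power)
      then have "int p ^ r dvd (1 - int a ^ (p - 1)) ^ r"
        by (rule dvd_power_same)
      with False show ?thesis
        by (simp add: cong_iff_dvd_diff)
    qed
    from padic_cong_of_int[OF this]
    have "padic_cong p r (of_nat a * (1 - of_nat a ^ (p - 1)) ^ r) (if p dvd a then of_nat a else 0)"
      by (cases "p dvd a") simp_all
    then show ?thesis
      using padic_cong_mult_left[OF padic_ints_of_int[of "(-1) ^ a"]] by simp
  qed
  have binom: "of_nat a * (1 - of_nat a ^ (p - 1)) ^ r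
      = (\<Sum>i\<le>r. of_nat (r choose i) * (-1) ^ i * of_nat a ^ (1 + i * (p - 1)) :: rat)" for a
  proof -
    have "(of_nat a :: rat) ^ (1 + i * (p - 1)) = of_nat a * (of_nat a ^ (p - 1)) ^ i" for i
      by (simp add: mult.commute flip: power_mult)
    then show ?thesis
      using binomial_ring[of "- (of_nat a ^ (p - 1)) :: rat" 1 r]
      by (simp only:) (simp add: sum_distrib_left power_minus[of "_ ^ _"] mult_ac)
  qed
  \<comment> \<open>The range a < p ^ 3 serves every r <= 3: the alternating sums are right modulo p
    ^ 3, hence modulo p ^ r.\<close>
  have "padic_cong p r (\<Sum>i\<le>r. of_nat (r choose i) * (-1) ^ i * euler_zero (1 + i * (p - 1)))
      (\<Sum>i\<le>r. of_nat (r choose i) * (-1) ^ i * (\<Sum>a<p ^ 3. (-1) ^ a * of_nat a ^ (1 + i * (p - 1))))"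
    using assms
    by (intro padic_cong_sum padic_cong_mult_left padic_ints_mult padic_ints_power padic_ints_minus
        padic_ints_0_1 padic_ints_of_nat padic_cong_sym[OF padic_cong_mono[OF alternating_power_sum_cong[OF p2]]])
  also have "(\<Sum>i\<le>r. of_nat (r choose i) * (-1) ^ i * (\<Sum>a<p ^ 3. (-1) ^ a * of_nat a ^ (1 + i * (p - 1))))
      = (\<Sum>a<p ^ 3. (-1) ^ a * (of_nat a * (1 - of_nat a ^ (p - 1)) ^ r) :: rat)"
    unfolding binom sum_distrib_left by (subst sum.swap) (simp add: mult_ac)
  also have "padic_cong p r \<dots> (\<Sum>a<p ^ 3. (-1) ^ a * (if p dvd a then of_nat a else 0))"
    by (intro padic_cong_sum single)
  also have "(\<Sum>a<p ^ 3. (-1) ^ a * (if p dvd a then of_nat a else 0))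
      = (\<Sum>a\<in>{a. a < p ^ 3 \<and> p dvd a}. (-1) ^ a * of_nat a :: rat)"
    by (intro sum.mono_neutral_cong_right) auto
  also have "\<dots> = (\<Sum>b<p ^ 2. (-1) ^ (p * b) * of_nat (p * b))"
    using prime_gt_0_nat[OF p]
    by (intro sum.reindex_bij_witness[of _ "\<lambda>b. p * b" "\<lambda>a. a div p"])
       (auto simp: power3_eq_cube power2_eq_square less_mult_imp_div_less mult_ac)
  also have "\<dots> = of_nat p * (\<Sum>b<p ^ 2. (-1) ^ b * of_nat b ^ 1)"
  proof -
    have "(-1 :: rat) ^ p = -1"
      using p p2 by (simp add: prime_odd_nat)
    then have "(-1 :: rat) ^ (p * b) = (-1) ^ b" for b
      by (simp only: power_mult)
    then show ?thesis
      by (simp only:) (simp add: sum_distrib_left mult_ac)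
  qed
  \<comment> \<open>The sum over b < p ^ 2 is known modulo p ^ 2 only; the factor p in front
    restores p ^ 3.\<close>
  also have "padic_cong p r \<dots> (of_nat p * euler_zero 1)"
  proof -
    obtain z where "z \<in> padic_ints p" "(\<Sum>b<p ^ 2. (-1) ^ b * of_nat b ^ 1) = euler_zero 1 + of_nat p ^ 2 * z"
      using alternating_power_sum_cong[OF p2, of 2 1] by (rule padic_congE)
    then have "padic_cong p 3 (of_nat p * (\<Sum>b<p ^ 2. (-1) ^ b * of_nat b ^ 1)) (of_nat p * euler_zero 1)"
      by (intro padic_congI[of z]) (auto simp: algebra_simps eval_nat_numeral)
    then show ?thesis
      using assms(2) by (rule padic_cong_mono)
  qed
  finally show ?thesis .
qed

section \<open>Kummer congruences\<close>

text \<open>Solve the definition of \<open>euler_zero\<close> for B_m / m. By Fermat, the condition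
  on 1 - 2 ^ m implies the classical one that p - 1 does not divide m.\<close>

lemma divided_bernoulli_in_padic_ints:
  assumes "p > 2" "m > 0" "\<not> int p dvd 1 - 2 ^ m"
  shows "divided_bernoulli m \<in> padic_ints p"
proof -
  have "1 / of_nat 2 \<in> padic_ints p"
    using assms by (intro padic_ints_inverse_of_nat) (auto dest: dvd_imp_le)
  then have "euler_zero (m - 1) * (1 / of_nat 2) * (1 / of_int (1 - 2 ^ m)) \<in> padic_ints p"
    using assms by (intro padic_ints_mult euler_zero_in_padic_ints padic_ints_inverse_of_int)
  moreover have "(1 - 2 ^ m :: int) \<noteq> 0"
    using assms by auto
  then have "(1 - 2 ^ m :: rat) \<noteq> 0"
    by (metis of_int_1 of_int_diff of_int_eq_0_iff of_int_numeral of_int_power)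
  ultimately show ?thesis
    using assms by (simp add: euler_zero_def)
qed

text \<open>Both the Euler values and the factors 1 - 2 ^ m are unchanged modulo p when m grows by a
  multiple of p - 1, and the factors are units.\<close>

lemma kummer_cong_1:
  assumes "p > 2" "m > 1" "\<not> int p dvd 1 - 2 ^ m"
  shows "padic_cong p 1 (divided_bernoulli (m + i * (p - 1))) (divided_bernoulli m)"
proof -
  let ?n = "m + i * (p - 1)"
  have "[int 2 ^ ?n = int 2 ^ m] (mod int p)"
    using assms by (intro fermat_cong_int) auto
  then have pow: "int p dvd 2 ^ ?n - 2 ^ m"
    by (simp add: cong_iff_dvd_diff)
  then obtain k where k: "(2::int) ^ ?n - 2 ^ m = int p * k"
    by (elim dvdE)
  have "(1 - 2 ^ ?n :: int) = (1 - 2 ^ m) - (2 ^ ?n - 2 ^ m)"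
    by simp
  then have "\<not> int p dvd 1 - 2 ^ ?n"
    using assms pow by (metis dvd_diff_right_iff dvd_diff_left_iff)
  then have int: "divided_bernoulli ?n \<in> padic_ints p"
    using assms by (intro divided_bernoulli_in_padic_ints) auto
  have "1 / of_nat 2 \<in> padic_ints p"
    using assms by (intro padic_ints_inverse_of_nat) (auto dest: dvd_imp_le)
  moreover have "1 / of_int (1 - 2 ^ m) \<in> padic_ints p"
    using assms by (intro padic_ints_inverse_of_int)
  moreover obtain z where z: "z \<in> padic_ints p"
    "euler_zero (m - 1 + i * (p - 1)) = euler_zero (m - 1) + of_nat p ^ 1 * z"
    using euler_zero_cong[OF assms(1), of "m - 1" i] assms by (auto elim: padic_congE)
  \<comment> \<open>With 2 ^ n = 2 ^ m + p k, the excess p k B_n / n of the factor moves to the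
    right-hand side; this explains the second summand.\<close>
  ultimately have wit: "(1 / of_nat 2 * z + of_int k * divided_bernoulli ?n) * (1 / of_int (1 - 2 ^ m)) \<in> padic_ints p"
    using int by (intro padic_ints_mult padic_ints_add padic_ints_of_int)
  have c: "(1 - 2 ^ m :: rat) \<noteq> 0"
    using assms by (metis dvd_0_right of_int_1 of_int_diff of_int_eq_0_iff of_int_numeral of_int_power)
  have "(of_int (2 ^ ?n - 2 ^ m) :: rat) = of_int (int p * k)"
    by (simp only: k)
  then have k': "(2 :: rat) ^ ?n = 2 ^ m + of_nat p * of_int k"
    by (simp add: algebra_simps)
  have "m - 1 + i * (p - 1) + 1 = ?n" "m - 1 + 1 = m"
    using assms by auto
  then have "2 * (1 - 2 ^ ?n) * divided_bernoulli ?n = 2 * (1 - 2 ^ m) * divided_bernoulli m + of_nat p * z"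
    using z unfolding euler_zero_def by simp
  then have "(1 - 2 ^ m) * divided_bernoulli ?n
      = (1 - 2 ^ m) * divided_bernoulli m + of_nat p * (1 / of_nat 2 * z + of_int k * divided_bernoulli ?n)"
    unfolding k' by (simp add: algebra_simps)
  then have "divided_bernoulli ?n = divided_bernoulli m
      + of_nat p ^ 1 * ((1 / of_nat 2 * z + of_int k * divided_bernoulli ?n) * (1 / of_int (1 - 2 ^ m)))"
    using c by (simp add: field_simps)
  then show ?thesis
    using wit by (rule padic_congI[rotated])
qed

lemma not_dvd_12:
  assumes "p > 5"
  shows "\<not> p dvd 12"
proof -
  have "\<not> p dvd 2 * 2 * 3"
    using p assms by (auto simp only: prime_dvd_mult_iff dest!: dvd_imp_le)
  then show ?thesis
    by simp
qed

lemma padic_ints_div_12: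
  assumes "p > 5" "x \<in> padic_ints p"
  shows "x / 12 \<in> padic_ints p"
  using padic_ints_mult[OF assms(2) padic_ints_inverse_of_nat[OF not_dvd_12[OF assms(1)]]] by simp

lemma divided_bernoulli_2: "divided_bernoulli 2 = 1 / 12"
proof -
  have "2 * euler_zero 1 = -1"
    using euler_zero_rec[of 1] by (simp add: euler_zero_0)
  then show ?thesis
    by (simp add: euler_zero_def flip: numeral_2_eq_2)
qed

text \<open>
  The third difference of \<open>(1 - 4 u ^ i) b\<^sub>i\<close> is divisible by
  \<open>p ^ 3\<close>, where \<open>u = 2 ^ (p - 1)\<close> and \<open>b\<^sub>0 = (1 - p) B\<^sub>2 / 2\<close>; since the
  \<open>j\<close>-th difference of \<open>1 - 4 u ^ i\<close> is divisible by \<open>p ^ j\<close>, Leibniz' rule passes this on to \<open>b\<^sub>i\<close>.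
\<close>

lemma kummer_cong_3:
  assumes "p > 5"
  shows "padic_cong p 3 (divided_bernoulli (3 * p - 1))
           (3 * divided_bernoulli (2 * p) - 3 * divided_bernoulli (p + 1) + (1 - of_nat p) / 12)"
proof -
  define P :: rat where "P = of_nat p"
  have P [simp, intro]: "P \<in> padic_ints p"
    by (simp add: P_def)
  define b0 where "b0 = (1 - P) / 12"
  define b1 where "b1 = divided_bernoulli (p + 1)"
  define b2 where "b2 = divided_bernoulli (2 * p)"
  define b3 where "b3 = divided_bernoulli (3 * p - 1)"
  define u :: rat where "u = 2 ^ (p - 1)"
  have p2: "p > 2" and p3: "p > 3"
    using assms by auto
  have nd: "\<not> p dvd 2" "\<not> int p dvd -3"
    using assms zdvd_imp_le[of "int p" 3] by (auto dest: dvd_imp_le)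
  have "(of_nat 2 :: rat) = 2"
    by simp
  then obtain w where w: "w \<in> padic_ints p" "u = 1 + P * w"
    using fermat_rat[OF nd(1)] unfolding u_def P_def by metis
  have b0: "b0 \<in> padic_ints p"
    unfolding b0_def using assms by (intro padic_ints_div_12) auto
  have half: "x / 2 \<in> padic_ints p" if "x \<in> padic_ints p" for x
    using padic_ints_mult[OF that padic_ints_inverse_of_nat[OF nd(1)]] by simp
  have c_eq: "1 - 4 * u = of_int (-3) + of_nat p * (- (4 * w))"
    "1 - 4 * u ^ 2 = of_int (-3) + of_nat p * (- (4 * (2 * w + P * w ^ 2)))"
    "1 - 4 * u ^ 3 = of_int (-3) + of_nat p * (- (4 * (3 * w + 3 * P * w ^ 2 + P ^ 2 * w ^ 3)))"
    by (simp_all add: w P_def algebra_simps eval_nat_numeral)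
  have c: "1 / (1 - 4 * u) \<in> padic_ints p" "1 / (1 - 4 * u ^ 2) \<in> padic_ints p" "1 / (1 - 4 * u ^ 3) \<in> padic_ints p"
    unfolding c_eq
    by (intro padic_ints_inverse_unit nd(2) padic_ints_minus padic_ints_mult padic_ints_add
        padic_ints_power padic_ints_numeral P w(1))+
  have u1: "u > 1"
    unfolding u_def using assms by (intro one_less_power) auto
  then have "1 - 4 * u ^ i < 0" for i
    using one_le_power[of u i] by linarith
  from this[of 1] this[of 2] this[of 3]
  have c0: "1 - 4 * u \<noteq> 0" "1 - 4 * u ^ 2 \<noteq> 0" "1 - 4 * u ^ 3 \<noteq> 0"
    by auto
  have e: "euler_zero (1 + i * (p - 1)) = 2 * (1 - 4 * u ^ i) * divided_bernoulli (2 + i * (p - 1))" for i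
    by (simp add: euler_zero_def u_def power_add power_mult mult.commute[of i])
  have idx: "2 + 1 * (p - 1) = p + 1" "2 + 2 * (p - 1) = 2 * p" "2 + 3 * (p - 1) = 3 * p - 1"
    using assms by auto
  have e0: "euler_zero 1 = - 1 / 2"
    using e[of 0] by (simp add: divided_bernoulli_2)
  have e1: "euler_zero (1 + 1 * (p - 1)) = 2 * (1 - 4 * u) * b1"
    unfolding e idx by (simp add: b1_def)
  have e2: "euler_zero (1 + 2 * (p - 1)) = 2 * (1 - 4 * u ^ 2) * b2"
    unfolding e idx by (simp add: b2_def)
  have e3: "euler_zero (1 + 3 * (p - 1)) = 2 * (1 - 4 * u ^ 3) * b3"
    unfolding e idx by (simp add: b3_def)
  have s: "(\<Sum>i\<le>1. f i) = f 0 + f 1" "(\<Sum>i\<le>2. f i) = f 0 + f 1 + f 2"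
    "(\<Sum>i\<le>3. f i) = f 0 + f 1 + f 2 + f 3" for f :: "nat \<Rightarrow> rat"
    by (simp_all add: eval_nat_numeral)
  have ch: "(3 choose 2) = (3 :: nat)" "(2 choose 1) = (2 :: nat)" "(3 choose 1) = (3 :: nat)"
    by (simp_all add: eval_nat_numeral)
  \<comment> \<open>Moving \<open>of_nat p * euler_zero 1\<close> to the left turns the term i = 0
    into (1 - p) E_1 = 2 * (-3) * b0. The common factor 2 is absorbed by z / 2, here and in the next
    two differences.\<close>
  obtain z1 where z1: "z1 \<in> padic_ints p" "-3 * b0 - (1 - 4 * u) * b1 = P * z1"
  proof -
    obtain z where "z \<in> padic_ints p"
      "(\<Sum>i\<le>1. of_nat (1 choose i) * (-1) ^ i * euler_zero (1 + i * (p - 1))) = of_nat p * euler_zero 1 + of_nat p ^ 1 * z"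
      using euler_zero_difference_cong[OF p3, of 1] by (auto elim: padic_congE)
    then show ?thesis
      unfolding s e1
      by (intro that[of "z / 2"] half) (simp_all add: e0[simplified] b0_def P_def field_simps)
  qed
  obtain z2 where z2: "z2 \<in> padic_ints p" "-3 * b0 - 2 * (1 - 4 * u) * b1 + (1 - 4 * u ^ 2) * b2 = P ^ 2 * z2"
  proof -
    obtain z where "z \<in> padic_ints p"
      "(\<Sum>i\<le>2. of_nat (2 choose i) * (-1) ^ i * euler_zero (1 + i * (p - 1))) = of_nat p * euler_zero 1 + of_nat p ^ 2 * z"
      using euler_zero_difference_cong[OF p3, of 2] by (auto elim: padic_congE)
    then show ?thesis
      unfolding s e1 e2 ch
      by (intro that[of "z / 2"] half) (simp_all add: e0[simplified] b0_def P_def field_simps)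
  qed
  obtain z3 where z3: "z3 \<in> padic_ints p"
    "-3 * b0 - 3 * (1 - 4 * u) * b1 + 3 * (1 - 4 * u ^ 2) * b2 - (1 - 4 * u ^ 3) * b3 = P ^ 3 * z3"
  proof -
    obtain z where "z \<in> padic_ints p"
      "(\<Sum>i\<le>3. of_nat (3 choose i) * (-1) ^ i * euler_zero (1 + i * (p - 1))) = of_nat p * euler_zero 1 + of_nat p ^ 3 * z"
      using euler_zero_difference_cong[OF p3, of 3] by (auto elim: padic_congE)
    then show ?thesis
      unfolding s e1 e2 e3 ch
      by (intro that[of "z / 2"] half) (simp_all add: e0[simplified] b0_def P_def field_simps)
  qed
  \<comment> \<open>Each yj is the j-th difference of the b's divided by P ^ j. The terms beside zj
    in its numerator are the Leibniz corrections: differences of 1 - 4 u ^ i produce powers of u - 1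
    = P w, and lower differences of b are replaced by P * y1 and P ^ 2 * y2.\<close>
  define y1 where "y1 = (z1 - 4 * w * b0) * (1 / (1 - 4 * u))"
  define y2 where "y2 = (z2 + 4 * w ^ 2 * b0 - 8 * u * w * y1) * (1 / (1 - 4 * u ^ 2))"
  define y3 where "y3 = (z3 - 4 * w ^ 3 * b0 + 12 * u * w ^ 2 * y1 - 12 * u ^ 2 * w * y2) * (1 / (1 - 4 * u ^ 3))"
  have u: "u \<in> padic_ints p"
    using w by simp
  have y1: "y1 \<in> padic_ints p"
    unfolding y1_def using z1 w b0 c by (intro padic_ints_mult padic_ints_diff padic_ints_numeral)
  have y2: "y2 \<in> padic_ints p"
    unfolding y2_def using z2 w b0 c y1 u
    by (intro padic_ints_mult padic_ints_diff padic_ints_add padic_ints_power padic_ints_numeral)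
  have y3: "y3 \<in> padic_ints p"
    unfolding y3_def using z3 w b0 c y1 y2 u
    by (intro padic_ints_mult padic_ints_diff padic_ints_add padic_ints_power padic_ints_numeral)
  have "(1 - 4 * u) * (b0 - b1) = P * (z1 - 4 * w * b0)"
    using z1(2) unfolding w(2) by (simp add: algebra_simps)
  then have b1_eq: "b1 = b0 - P * y1"
    using c0(1) by (simp add: y1_def field_simps)
  have "(1 - 4 * u ^ 2) * (b0 - 2 * b1 + b2)
      = (-3 * b0 - 2 * (1 - 4 * u) * b1 + (1 - 4 * u ^ 2) * b2) + (4 - 4 * u ^ 2) * b0 - 2 * (4 * u - 4 * u ^ 2) * b1"
    by (simp add: algebra_simps)
  also have "\<dots> = P ^ 2 * (z2 + 4 * w ^ 2 * b0 - 8 * u * w * y1)"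
    unfolding z2(2) unfolding b1_eq w(2) by (simp add: algebra_simps eval_nat_numeral)
  finally have b2_eq: "b2 = P ^ 2 * y2 - b0 + 2 * b1"
    using c0(2) by (simp add: y2_def field_simps)
  have "(1 - 4 * u ^ 3) * (b0 - 3 * b1 + 3 * b2 - b3)
      = (-3 * b0 - 3 * (1 - 4 * u) * b1 + 3 * (1 - 4 * u ^ 2) * b2 - (1 - 4 * u ^ 3) * b3)
        + (4 - 4 * u ^ 3) * b0 - 3 * (4 * u - 4 * u ^ 3) * b1 + 3 * (4 * u ^ 2 - 4 * u ^ 3) * b2"
    by (simp add: algebra_simps)
  also have "\<dots> = P ^ 3 * (z3 - 4 * w ^ 3 * b0 + 12 * u * w ^ 2 * y1 - 12 * u ^ 2 * w * y2)"
    unfolding z3(2) unfolding b2_eq b1_eq w(2) by (simp add: algebra_simps eval_nat_numeral)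
  finally have "b3 = b0 - 3 * b1 + 3 * b2 - P ^ 3 * y3"
    using c0(3) by (simp add: y3_def field_simps)
  then show ?thesis
    using y3 unfolding b0_def b1_def b2_def b3_def P_def
    by (intro padic_congI[of "- y3"]) auto
qed

section \<open>Residues of p B_m modulo p and p ^ 2\<close>

lemma p_bernoulli_cong_power_sum:
  assumes "p > 5" "even m" "m \<ge> 6"
  shows "padic_cong p 2 (of_nat p * bernoulli m) (\<Sum>a=1..p-1. of_nat a ^ m)"
proof -
  obtain z where z: "z \<in> padic_ints p" "(\<Sum>a=1..p-1. of_nat a ^ m) = of_nat p * bernoulli m
      + of_nat m * (of_nat m - 1) / 6 * of_nat p ^ 2 * (of_nat p * bernoulli (m - 2)) + of_nat p ^ 4 * z"
    using power_sum_cong[OF assms] by (rule padic_congE)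
  define x where "x = of_nat m * (of_nat m - 1) * (of_nat p * bernoulli (m - 2))"
  have "x \<in> padic_ints p"
    unfolding x_def by (intro padic_ints_mult[OF _ p_bernoulli_in_padic_ints]) auto
  then have "2 * x / 12 \<in> padic_ints p"
    using assms by (intro padic_ints_div_12) auto
  then have "- (2 * x / 12) - of_nat p ^ 2 * z \<in> padic_ints p"
    using z(1) by blast
  then show ?thesis
    unfolding z(2) by (rule padic_congI) (simp add: x_def field_simps eval_nat_numeral)
qed

text \<open>By Fermat each of the p - 1 summands of the power sum is 1 modulo p.\<close>

lemma p_bernoulli_cong_minus_1:
  assumes "p > 5" "k > 0"
  shows "padic_cong p 1 (of_nat p * bernoulli (k * (p - 1))) (-1)"
proof -
  have odd: "odd p"
    using p assms by (simp add: prime_odd_nat)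
  have "1 * (p - 1) \<le> k * (p - 1)"
    using assms by (intro mult_le_mono1) auto
  moreover have "p - 1 \<ge> 6"
    using odd assms by presburger
  ultimately have "k * (p - 1) \<ge> 6"
    by linarith
  then have "padic_cong p 2 (of_nat p * bernoulli (k * (p - 1))) (\<Sum>a=1..p-1. of_nat a ^ (k * (p - 1)))"
    using assms odd by (intro p_bernoulli_cong_power_sum) auto
  then have "padic_cong p 1 (of_nat p * bernoulli (k * (p - 1))) (\<Sum>a=1..p-1. of_nat a ^ (k * (p - 1)))"
    by (rule padic_cong_mono) simp
  also have "padic_cong p 1 \<dots> (\<Sum>a=1..p-1. 1)"
  proof (intro padic_cong_sum)
    fix a assume "a \<in> {1..p-1}"
    then have "\<not> p dvd a"
      by (auto dest: dvd_imp_le)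
    then have "[(a ^ (p - 1)) ^ k = 1 ^ k] (mod p)"
      using fermat_theorem[OF p] by (intro cong_pow)
    then have "[int (a ^ (k * (p - 1))) = int 1] (mod int p ^ 1)"
      unfolding cong_int_iff power_one_right by (simp add: mult.commute flip: power_mult)
    from padic_cong_of_int[OF this] show "padic_cong p 1 (of_nat a ^ (k * (p - 1))) 1"
      by simp
  qed
  also have "padic_cong p 1 (\<Sum>a=1..p-1. 1) (-1)"
    using assms by (intro padic_congI[of 1]) (auto simp: of_nat_diff)
  finally show ?thesis .
qed

text \<open>Linearise u ^ 3 at u = a ^ (p - 1), which is 1 modulo p. Precision p ^ 2 is required for
  the exponent m = 3 p - 1: there m (m - 1) is prime to p apart from constants, whereas p + 1 and 2
  p supply an additional factor p.\<close>

lemma p_bernoulli_cong_3: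
  assumes "p > 5"
  shows "padic_cong p 2 (of_nat p * bernoulli (3 * (p - 1)))
           (3 * (of_nat p * bernoulli (p - 1)) - 2 * (of_nat p - 1))"
proof -
  have odd: "odd p"
    using p assms by (simp add: prime_odd_nat)
  then have ev: "even (p - 1)" "p - 1 \<ge> 6"
    using assms by (simp, presburger)
  have "padic_cong p 2 (of_nat p * bernoulli (3 * (p - 1))) (\<Sum>a=1..p-1. of_nat a ^ (3 * (p - 1)))"
    using assms ev by (intro p_bernoulli_cong_power_sum) auto
  also have "padic_cong p 2 \<dots> (\<Sum>a=1..p-1. 3 * of_nat a ^ (p - 1) - 2)"
  proof (intro padic_cong_sum)
    fix a assume "a \<in> {1..p-1}"
    then have "\<not> p dvd a"
      by (auto dest: dvd_imp_le)
    then obtain w where w: "w \<in> padic_ints p" "(of_nat a :: rat) ^ (p - 1) = 1 + of_nat p * w"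
      by (rule fermat_rat)
    have "(of_nat a :: rat) ^ (3 * (p - 1)) = (of_nat a ^ (p - 1)) ^ 3"
      by (simp add: mult.commute flip: power_mult)
    then show "padic_cong p 2 (of_nat a ^ (3 * (p - 1))) (3 * of_nat a ^ (p - 1) - 2)"
      using w(1) unfolding w(2)
      by (intro padic_congI[of "3 * w ^ 2 + of_nat p * w ^ 3"]) (auto simp: algebra_simps eval_nat_numeral)
  qed
  also have "(\<Sum>a=1..p-1. 3 * of_nat a ^ (p - 1) - 2)
      = 3 * (\<Sum>a=1..p-1. of_nat a ^ (p - 1)) - 2 * (of_nat p - 1 :: rat)"
    using assms by (simp add: sum_subtractf sum_distrib_left of_nat_diff)
  also have "padic_cong p 2 \<dots> (3 * (of_nat p * bernoulli (p - 1)) - 2 * (of_nat p - 1))"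
    using assms ev
    by (intro padic_cong_diff padic_cong_refl padic_cong_mult_left padic_ints_numeral
        padic_cong_sym[OF p_bernoulli_cong_power_sum]) auto
  finally show ?thesis .
qed

section \<open>The two harmonic numbers\<close>

text \<open>The exponent 2 lies below the range of \<open>power_sum_cong\<close>, so its power sum
  is evaluated exactly.\<close>

lemma sum_squares_below:
  "(\<Sum>a=1..p-1. of_nat a ^ 2 :: rat) = (of_nat p - 1) * of_nat p * (2 * of_nat p - 1) / 6"
proof -
  have "(\<Sum>a=1..n. of_nat a ^ 2 :: rat) = of_nat n * (of_nat n + 1) * (2 * of_nat n + 1) / 6" for n
    by (induction n) (simp_all add: field_simps power2_eq_square)
  from this[of "p - 1"] show ?thesis
    using prime_gt_0_nat[OF p] by (simp add: of_nat_diff algebra_simps)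
qed

text \<open>By Fermat the first number is 1 - 4 = -3 modulo p, and 16 times the second is 16 - 2 ^
  (p + 1), that is 12.\<close>

lemma not_dvd_1_minus_2_power:
  assumes "p > 5"
  shows "\<not> int p dvd 1 - 2 ^ (2 + i * (p - 1))" "\<not> int p dvd 1 - 2 ^ (p - 3)"
proof -
  have 3: "\<not> int p dvd 3"
    using assms zdvd_imp_le[of "int p" 3] by auto
  have "int p dvd 2 ^ (2 + i * (p - 1)) - 2 ^ 2"
    using fermat_cong_int[of 2 2 i] by (simp add: cong_iff_dvd_diff)
  then have "int p dvd 3" if "int p dvd 1 - 2 ^ (2 + i * (p - 1))"
    using dvd_add[OF that] by fastforce
  then show "\<not> int p dvd 1 - 2 ^ (2 + i * (p - 1))"
    using 3 by blast
  have "int p dvd 2 ^ (2 + 1 * (p - 1)) - 2 ^ 2"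
    using fermat_cong_int[of 2 2 1] by (simp add: cong_iff_dvd_diff)
  moreover have "2 + 1 * (p - 1) = 4 + (p - 3)"
    using assms by simp
  ultimately have "int p dvd 2 ^ (4 + (p - 3)) - 2 ^ 2"
    by (simp only:)
  then have "int p dvd 12" if "int p dvd 1 - 2 ^ (p - 3)"
    using dvd_add[OF _ dvd_mult[OF that, of 16]] by (fastforce simp: power_add)
  then show "\<not> int p dvd 1 - 2 ^ (p - 3)"
    using not_dvd_12[OF assms] by (metis int_dvd_int_iff of_nat_numeral)
qed

lemma gen_harmonic_p_minus_3:
  assumes "p > 5"
  shows "padic_cong p 4 (gen_harmonic (p - 1) (p - 3))
           (37 * of_nat p ^ 3 / 12 - 3 * of_nat p ^ 2 + 3 * of_nat p / 4
            - of_nat p ^ 2 * (of_nat p * bernoulli (p - 1))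
            + 3 * of_nat p * (of_nat p - 3) * divided_bernoulli (p + 1)
            - 1 / 2 * (of_nat p - 3 + 11 * of_nat p ^ 3 / 2) * bernoulli (2 * p))"
proof -
  define P :: rat where "P = of_nat p"
  have P: "P \<in> padic_ints p"
    by (simp add: P_def)
  define b1 where "b1 = divided_bernoulli (p + 1)"
  define b2 where "b2 = divided_bernoulli (2 * p)"
  have idx: "2 + 1 * (p - 1) = p + 1" "2 + 2 * (p - 1) = 2 * p" "2 + 3 * (p - 1) = 3 * p - 1"
    "p + 1 - 2 = 1 * (p - 1)" "2 * p - 2 = 2 * (p - 1)" "3 * p - 1 - 2 = 3 * (p - 1)"
    using assms by auto
  have odd: "odd p"
    using p assms by (simp add: prime_odd_nat)
  have b2: "b2 \<in> padic_ints p"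
    unfolding b2_def idx(2)[symmetric] using not_dvd_1_minus_2_power[OF assms] assms
    by (intro divided_bernoulli_in_padic_ints) auto
  have B1: "bernoulli (p + 1) = (P + 1) * b1" and B2: "bernoulli (2 * p) = 2 * P * b2"
    and B3: "bernoulli (3 * p - 1) = (3 * P - 1) * divided_bernoulli (3 * p - 1)"
    using assms by (simp_all add: P_def b1_def b2_def divided_bernoulli_def field_simps of_nat_diff)
  obtain y where y: "y \<in> padic_ints p"
    "divided_bernoulli (3 * p - 1) = 3 * b2 - 3 * b1 + (1 - P) / 12 + P ^ 3 * y"
    using kummer_cong_3[OF assms] unfolding b1_def b2_def P_def by (rule padic_congE)
  obtain a where a: "a \<in> padic_ints p" "P * bernoulli (p - 1) = -1 + P * a"
    using p_bernoulli_cong_minus_1[OF assms, of 1] by (auto simp: P_def elim: padic_congE)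
  obtain a2 where a2: "a2 \<in> padic_ints p" "P * bernoulli (2 * (p - 1)) = -1 + P * a2"
    using p_bernoulli_cong_minus_1[OF assms, of 2] by (auto simp: P_def elim: padic_congE)
  obtain a3 where a3: "a3 \<in> padic_ints p"
    "P * bernoulli (3 * (p - 1)) = 3 * (-1 + P * a) - 2 * (P - 1) + P ^ 2 * a3"
    using p_bernoulli_cong_3[OF assms] unfolding P_def[symmetric] a(2) by (metis padic_congE P_def)
  let ?S = "\<lambda>m. \<Sum>a=1..p-1. of_nat a ^ m :: rat"
  obtain s1 where s1: "s1 \<in> padic_ints p"
    "?S (p + 1) = P * ((P + 1) * b1) + (P + 1) * P / 6 * P ^ 2 * (-1 + P * a) + P ^ 4 * s1"
  proof -
    have "of_nat (p + 1) = P + 1"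
      by (simp add: P_def)
    moreover have "p + 1 \<ge> 6"
      using assms by simp
    ultimately have "padic_cong p 4 (?S (p + 1)) (P * ((P + 1) * b1) + (P + 1) * (P + 1 - 1) / 6 * P ^ 2 * (-1 + P * a))"
      using power_sum_cong[OF assms, of "p + 1"] odd unfolding idx B1 P_def[symmetric] mult_1 a(2)
      by (simp only:) simp
    then show ?thesis
      using that unfolding P_def by (elim padic_congE) simp
  qed
  obtain s2 where s2: "s2 \<in> padic_ints p"
    "?S (2 * p) = P * (2 * P * b2) + 2 * P * (2 * P - 1) / 6 * P ^ 2 * (-1 + P * a2) + P ^ 4 * s2"
  proof -
    have "padic_cong p 4 (?S (2 * p)) (P * (2 * P * b2) + 2 * P * (2 * P - 1) / 6 * P ^ 2 * (-1 + P * a2))"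
      using power_sum_cong[OF assms, of "2 * p"] assms odd unfolding idx B2 P_def[symmetric] a2
      by (simp add: P_def)
    then show ?thesis
      using that unfolding P_def by (rule padic_congE)
  qed
  obtain s3 where s3: "s3 \<in> padic_ints p"
    "?S (3 * p - 1) = P * ((3 * P - 1) * (3 * b2 - 3 * b1 + (1 - P) / 12 + P ^ 3 * y))
       + (3 * P - 1) * (3 * P - 2) / 6 * P ^ 2 * (3 * (-1 + P * a) - 2 * (P - 1) + P ^ 2 * a3) + P ^ 4 * s3"
  proof -
    have "of_nat (3 * p - 1) = 3 * P - 1"
      using assms by (simp add: P_def of_nat_diff)
    then have "padic_cong p 4 (?S (3 * p - 1)) (P * ((3 * P - 1) * (3 * b2 - 3 * b1 + (1 - P) / 12 + P ^ 3 * y))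
       + (3 * P - 1) * (3 * P - 1 - 1) / 6 * P ^ 2 * (3 * (-1 + P * a) - 2 * (P - 1) + P ^ 2 * a3))"
      using power_sum_cong[OF assms, of "3 * p - 1"] assms odd unfolding idx B3 P_def[symmetric] a3 y
      by simp
    then show ?thesis
      using that unfolding P_def by (elim padic_congE) simp
  qed
  have "gen_harmonic (p - 1) (p - 3) = (\<Sum>a=1..p-1. of_nat a ^ 2 / of_nat a ^ (p - 1))"
    unfolding gen_harmonic_def
  proof (intro sum.cong refl)
    fix a assume "a \<in> {1..p-1}"
    moreover have "(of_nat a :: rat) ^ (p - 1) = of_nat a ^ 2 * of_nat a ^ (p - 3)"
      unfolding power_add[symmetric] using assms by (intro arg_cong[of _ _ "\<lambda>n. _ ^ n"]) simp
    ultimately show "1 / of_nat a ^ (p - 3) = (of_nat a ^ 2 / of_nat a ^ (p - 1) :: rat)"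
      by simp
  qed
  then have "padic_cong p 4 (gen_harmonic (p - 1) (p - 3))
      (4 * ((P - 1) * P * (2 * P - 1) / 6) - 6 * ?S (p + 1) + 4 * ?S (2 * p) - ?S (3 * p - 1))"
    using power_sum_quotient_cong[of 2] idx(1) unfolding sum_squares_below idx(2,3) P_def by simp
  then obtain h where h: "h \<in> padic_ints p" "gen_harmonic (p - 1) (p - 3)
      = 4 * ((P - 1) * P * (2 * P - 1) / 6) - 6 * ?S (p + 1) + 4 * ?S (2 * p) - ?S (3 * p - 1) + P ^ 4 * h"
    unfolding P_def by (rule padic_congE)
  \<comment> \<open>W is 12 / P ^ 4 times the difference of the two sides after all substitutions;
    12 is a unit. The b1 terms match exactly, as -6 P (P + 1) + 3 P (3 P - 1) = 3 P (P - 3). The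
    summand 66 * b2 comes from 11 p ^ 3 / 2 in the claim, because B_2p = 2 P b2.\<close>
  define W where "W = 42 * a - 66 * a * P - 16 * a2 + 32 * a2 * P - 4 * a3 + 18 * a3 * P - 18 * a3 * P ^ 2
      + 66 * b2 + 12 * h - 38 - 72 * s1 + 48 * s2 - 12 * s3 + 12 * y + 36 * P - 36 * P * y"
  have "W \<in> padic_ints p"
    unfolding W_def using P a a2 a3 b2 h s1 s2 s3 y
    by (intro padic_ints_add padic_ints_diff padic_ints_mult padic_ints_power padic_ints_numeral)
  then show ?thesis
    unfolding P_def[symmetric] b1_def[symmetric] h(2) s1(2) s2(2) s3(2) a(2) B2
    using assms by (intro padic_congI[of "W / 12"] padic_ints_div_12)
      (auto simp: W_def P_def[symmetric] field_simps eval_nat_numeral)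
qed

text \<open>
  By Kummer's congruence the three Bernoulli numbers in the terms of order \<open>p ^ 3\<close> are all
  determined modulo \<open>p\<close> by the first one, and their contributions cancel.
\<close>

lemma gen_harmonic_p_minus_1:
  assumes "p > 5"
  shows "padic_cong p 4 (gen_harmonic (p - 1) (p - 1))
           ((13 * of_nat p ^ 3 + 12 * of_nat p - 12) / 3
            + (19 * of_nat p ^ 3 - 12) / 2 * (of_nat p * bernoulli (p - 1))
            + (4 - 7 * of_nat p ^ 3) * (of_nat p * bernoulli (2 * (p - 1)))
            + (11 * of_nat p ^ 3 - 6) / 6 * (of_nat p * bernoulli (3 * (p - 1))))"
proof -
  define P :: rat where "P = of_nat p"
  have P: "P \<in> padic_ints p"
    by (simp add: P_def)
  define g where "g = divided_bernoulli (p - 3)"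
  have nd: "\<not> int p dvd 1 - 2 ^ (p - 3)"
    using not_dvd_1_minus_2_power(2)[OF assms] .
  have g: "g \<in> padic_ints p"
    unfolding g_def using nd assms by (intro divided_bernoulli_in_padic_ints) auto
  have odd: "odd p"
    using p assms by (simp add: prime_odd_nat)
  obtain a1 where a1: "a1 \<in> padic_ints p" "P * bernoulli (p - 1) = -1 + P * a1"
    using p_bernoulli_cong_minus_1[OF assms, of 1] by (auto simp: P_def elim: padic_congE)
  obtain a2 where a2: "a2 \<in> padic_ints p" "P * bernoulli (2 * (p - 1)) = -1 + P * a2"
    using p_bernoulli_cong_minus_1[OF assms, of 2] by (auto simp: P_def elim: padic_congE)
  obtain a3 where a3: "a3 \<in> padic_ints p" "P * bernoulli (3 * (p - 1)) = -1 + P * a3"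
    using p_bernoulli_cong_minus_1[OF assms, of 3] by (auto simp: P_def elim: padic_congE)
  have kummer: "\<exists>z\<in>padic_ints p. bernoulli ((k + 1) * (p - 1) - 2) = (of_nat (k + 1) * (P - 1) - 2) * (g + P * z)" for k
  proof -
    have idx: "p - 3 + k * (p - 1) = (k + 1) * (p - 1) - 2"
      using assms by simp
    have "padic_cong p 1 (divided_bernoulli (p - 3 + k * (p - 1))) g"
      unfolding g_def using assms nd by (intro kummer_cong_1) auto
    then obtain z where z: "z \<in> padic_ints p" "divided_bernoulli ((k + 1) * (p - 1) - 2) = g + P * z"
      unfolding idx P_def by (metis padic_congE power_one_right)
    have le: "2 < (k + 1) * (p - 1)"
      using assms by simp
    then have "(of_nat ((k + 1) * (p - 1) - 2) :: rat) = of_nat ((k + 1) * (p - 1)) - of_nat 2"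
      by (intro of_nat_diff) simp
    also have "\<dots> = of_nat (k + 1) * (P - 1) - 2"
      unfolding of_nat_mult using assms by (simp add: P_def of_nat_diff)
    finally have n: "(of_nat ((k + 1) * (p - 1) - 2) :: rat) = of_nat (k + 1) * (P - 1) - 2" .
    have "bernoulli n = of_nat n * divided_bernoulli n" if "n > 0" for n
      using that by (simp add: divided_bernoulli_def)
    from this[of "(k + 1) * (p - 1) - 2"]
    have "bernoulli ((k + 1) * (p - 1) - 2) = (of_nat (k + 1) * (P - 1) - 2) * (g + P * z)"
      using le unfolding n z(2) by linarith
    then show ?thesis
      using z by blast
  qed
  let ?S = "\<lambda>m. \<Sum>a=1..p-1. of_nat a ^ m :: rat"
  have S: "\<exists>z\<in>padic_ints p. \<exists>s\<in>padic_ints p. ?S ((k + 1) * (p - 1)) = P * bernoulli ((k + 1) * (p - 1))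
      + of_nat (k + 1) * (P - 1) * (of_nat (k + 1) * (P - 1) - 1) / 6 * P ^ 2
        * (P * ((of_nat (k + 1) * (P - 1) - 2) * (g + P * z))) + P ^ 4 * s" for k
  proof -
    have m: "(of_nat ((k + 1) * (p - 1)) :: rat) = of_nat (k + 1) * (P - 1)"
      unfolding of_nat_mult using assms by (simp add: P_def of_nat_diff)
    have "1 * (p - 1) \<le> (k + 1) * (p - 1)"
      by (intro mult_le_mono1) auto
    moreover have "p - 1 \<ge> 6"
      using odd assms by presburger
    ultimately have "(k + 1) * (p - 1) \<ge> 6"
      by linarith
    moreover have "even ((k + 1) * (p - 1))"
      using odd by simp
    ultimately obtain s where "s \<in> padic_ints p" "?S ((k + 1) * (p - 1)) = of_nat p * bernoulli ((k + 1) * (p - 1))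
        + of_nat ((k + 1) * (p - 1)) * (of_nat ((k + 1) * (p - 1)) - 1) / 6 * of_nat p ^ 2
          * (of_nat p * bernoulli ((k + 1) * (p - 1) - 2)) + of_nat p ^ 4 * s"
      using power_sum_cong[OF assms] by (metis padic_congE)
    moreover obtain z where "z \<in> padic_ints p"
      "bernoulli ((k + 1) * (p - 1) - 2) = (of_nat (k + 1) * (P - 1) - 2) * (g + P * z)"
      using kummer by blast
    ultimately show ?thesis
      unfolding m P_def[symmetric] by metis
  qed
  have "2 + 1 = (3 :: nat)"
    by simp
  note S3 = S[of 2, unfolded this of_nat_numeral a3(2)]
  obtain g1 s1 where s1: "g1 \<in> padic_ints p" "s1 \<in> padic_ints p" "?S (p - 1) = -1 + P * a1
      + (P - 1) * (P - 1 - 1) / 6 * P ^ 2 * (P * ((P - 1 - 2) * (g + P * g1))) + P ^ 4 * s1"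
    using S[of 0, unfolded add_0 mult_1 of_nat_1 a1(2)] by blast
  obtain g2 s2 where s2: "g2 \<in> padic_ints p" "s2 \<in> padic_ints p" "?S (2 * (p - 1)) = -1 + P * a2
      + 2 * (P - 1) * (2 * (P - 1) - 1) / 6 * P ^ 2 * (P * ((2 * (P - 1) - 2) * (g + P * g2))) + P ^ 4 * s2"
    using S[of 1, unfolded one_add_one of_nat_numeral a2(2)] by blast
  obtain g3 s3 where s3: "g3 \<in> padic_ints p" "s3 \<in> padic_ints p" "?S (3 * (p - 1)) = -1 + P * a3
      + 3 * (P - 1) * (3 * (P - 1) - 1) / 6 * P ^ 2 * (P * ((3 * (P - 1) - 2) * (g + P * g3))) + P ^ 4 * s3"
    using S3 by blast
  have "padic_cong p 4 (gen_harmonic (p - 1) (p - 1))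
      (4 * (P - 1) - 6 * ?S (p - 1) + 4 * ?S (2 * (p - 1)) - ?S (3 * (p - 1)))"
    using power_sum_quotient_cong[of 0] assms by (simp add: gen_harmonic_def P_def of_nat_diff)
  then obtain h where h: "h \<in> padic_ints p" "gen_harmonic (p - 1) (p - 1)
      = 4 * (P - 1) - 6 * ?S (p - 1) + 4 * ?S (2 * (p - 1)) - ?S (3 * (p - 1)) + P ^ 4 * h"
    unfolding P_def by (rule padic_congE)
  \<comment> \<open>Again 12 / P ^ 4 times the difference. That g has no term of order P ^ 3
    reflects a fourth difference: modulo p, m = k (p - 1) is -k, the weights 4, -6, 4, -1 at k = 0,
    ..., 3 extend by -1 at k = -1, and the cubic m (m - 1) (m - 2) vanishes at that added point m =
    1.\<close>
  define W where "W = - 114 * a1 + 84 * a2 - 22 * a3 + 2 * g - 2 * g * P ^ 2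
      - 12 * (P - 1) * (P - 2) * (P - 3) * g1
      - 192 * g2 + 416 * g2 * P - 288 * g2 * P ^ 2 + 64 * g2 * P ^ 3
      + 120 * g3 - 282 * g3 * P + 216 * g3 * P ^ 2 - 54 * g3 * P ^ 3 + 12 * h - 72 * s1 + 48 * s2 - 12 * s3"
  have "W \<in> padic_ints p"
    unfolding W_def using P a1 a2 a3 g h s1 s2 s3
    by (intro padic_ints_add padic_ints_diff padic_ints_mult padic_ints_power padic_ints_numeral
        padic_ints_minus padic_ints_0_1)
  then show ?thesis
    unfolding P_def[symmetric] h(2) s1(3) s2(3) s3(3) a1(2) a2(2) a3(2)
    using assms by (intro padic_congI[of "W / 12"] padic_ints_div_12)
      (auto simp: W_def P_def[symmetric] field_simps eval_nat_numeral)
qed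

end

theorem theorem2:
  fixes p :: nat
  assumes "prime p" and "p > 5"
  shows "padic_cong p 4 (gen_harmonic (p - 1) (p - 3))
           (37 * of_nat p ^ 3 / 12 - 3 * of_nat p ^ 2 + 3 * of_nat p / 4
            - of_nat p ^ 2 * (of_nat p * bernoulli (p - 1))
            + 3 * of_nat p * (of_nat p - 3) * divided_bernoulli (p + 1)
            - 1 / 2 * (of_nat p - 3 + 11 * of_nat p ^ 3 / 2) * bernoulli (2 * p))
         \<and> padic_cong p 4 (gen_harmonic (p - 1) (p - 1))
           ((13 * of_nat p ^ 3 + 12 * of_nat p - 12) / 3
            + (19 * of_nat p ^ 3 - 12) / 2 * (of_nat p * bernoulli (p - 1))
            + (4 - 7 * of_nat p ^ 3) * (of_nat p * bernoulli (2 * (p - 1)))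
            + (11 * of_nat p ^ 3 - 6) / 6 * (of_nat p * bernoulli (3 * (p - 1))))"
  using gen_harmonic_p_minus_3[OF assms] gen_harmonic_p_minus_1[OF assms] by (rule conjI)

end
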